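(* Let $r_1,\ldots,r_m$ and $c_1,\ldots,c_n$ be positive integers with $r_1+\cdots+r_m=c_1+\cdots+c_n=N$, and let $w_{ij}$ ($i=1,\ldots,m$, $j=1,\ldots,n$) be real numbers. Let $\gamma=(\gamma_{ij})$ be an $m\times n$ matrix of independent standard exponential random variables. Partition the row index set $\{1,\ldots,N\}$ of an $N\times N$ matrix into disjoint subsets $R_1,\ldots,R_m$ with $|R_i|=r_i$ and the column index set $\{1,\ldots,N\}$ into disjoint subsets $C_1,\ldots,C_n$ with $|C_j|=c_j$, and define the random $N\times N$ matrix $A=A(\gamma)$ by letting every entry in the block $R_i\times C_j$ equal $w_{ij}\gamma_{ij}$. Then $$T(R,C;W)=\frac{\mathbf{E}\,\operatorname{per}A}{r_1!\cdots r_m!\,c_1!\cdots c_n!},$$ where $T(R,C;W)=\sum_D\prod_{i,j}w_{ij}^{d_{ij}}$, the sum over all $m\times n$ non-negative integer matrices $D=(d_{ij})$ with row sums $r_1,\ldots,r_m$ and column sums $c_1,\ldots,c_n$.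
   Context: A random variable $\gamma$ is standard exponential if $\mathbf{P}(\gamma\ge t)=e^{-t}$ for $t>0$ and $=1$ for $t\le 0$. The permanent of an $N\times N$ matrix $A=(a_{pq})$ is $\operatorname{per}A=\sum_\pi\prod_{k=1}^N a_{k\pi(k)}$, the sum over all permutations $\pi$ of $\{1,\ldots,N\}$. The convention $0^0=1$ is used. *)

theory Defs
  imports "HOL-Probability.Probability" "HOL-Combinatorics.Permutations"
begin

text \<open>
  Matrices are functions of two natural-number arguments, with the indices starting at 1;
  dimensions are passed explicitly.
\<close>

definition permanent :: "nat \<Rightarrow> (nat \<Rightarrow> nat \<Rightarrow> 'a::comm_ring_1) \<Rightarrow> 'a" where
  "permanent N A = (\<Sum>\<pi> | \<pi> permutes {1..N}. \<Prod>k=1..N. A k (\<pi> k))"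

text \<open>
  Setting the entries outside the index range to zero makes each matrix correspond to exactly one
  function, so that the sum below counts every matrix once.
\<close>

definition contingency_tables ::
    "nat \<Rightarrow> nat \<Rightarrow> (nat \<Rightarrow> nat) \<Rightarrow> (nat \<Rightarrow> nat) \<Rightarrow> (nat \<Rightarrow> nat \<Rightarrow> nat) set" where
  "contingency_tables m n r c =
     {D. (\<forall>i j. (i, j) \<notin> {1..m} \<times> {1..n} \<longrightarrow> D i j = 0) \<and>
         (\<forall>i\<in>{1..m}. (\<Sum>j=1..n. D i j) = r i) \<and>
         (\<forall>j\<in>{1..n}. (\<Sum>i=1..m. D i j) = c j)}"

lemma finite_contingency_tables: "finite (contingency_tables m n r c)"
proof -
  let ?F = "{f :: nat \<times> nat \<Rightarrow> nat. \<forall>x. (x \<in> {1..m} \<times> {1..n} \<longrightarrow> f x \<in> {..(\<Sum>i=1..m. r i)}) \<and>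
              (x \<notin> {1..m} \<times> {1..n} \<longrightarrow> f x = 0)}"
  have "finite ?F"
    by (rule finite_set_of_finite_funs) auto
  moreover have "case_prod D \<in> ?F" if D: "D \<in> contingency_tables m n r c" for D
  proof -
    have "D i j \<le> (\<Sum>i=1..m. r i)" if ij: "i \<in> {1..m}" "j \<in> {1..n}" for i j
    proof -
      have "D i j \<le> (\<Sum>j=1..n. D i j)"
        using ij by (intro member_le_sum) auto
      also have "\<dots> = r i"
        using D ij by (auto simp: contingency_tables_def)
      also have "\<dots> \<le> (\<Sum>i=1..m. r i)"
        using ij by (intro member_le_sum) auto
      finally show ?thesis .
    qed
    moreover have "D i j = 0" if "(i, j) \<notin> {1..m} \<times> {1..n}" for i j
      using D that unfolding contingency_tables_def by blast
    ultimately show ?thesis by auto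
  qed
  ultimately have "finite (case_prod ` contingency_tables m n r c)"
    by (meson finite_subset image_subsetI)
  moreover have "inj_on case_prod (contingency_tables m n r c)"
    by (rule inj_onI) (metis curry_case_prod)
  ultimately show ?thesis
    by (rule finite_imageD)
qed

definition weighted_tables ::
    "nat \<Rightarrow> nat \<Rightarrow> (nat \<Rightarrow> nat) \<Rightarrow> (nat \<Rightarrow> nat) \<Rightarrow> (nat \<Rightarrow> nat \<Rightarrow> real) \<Rightarrow> real" where
  "weighted_tables m n r c w =
     (\<Sum>D\<in>contingency_tables m n r c. \<Prod>i=1..m. \<Prod>j=1..n. w i j ^ D i j)"

definition standard_exponential :: "'a measure \<Rightarrow> ('a \<Rightarrow> real) \<Rightarrow> bool" where
  "standard_exponential M X \<longleftrightarrow> X \<in> borel_measurable M \<and>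
     (\<forall>t. measure M {x \<in> space M. X x \<ge> t} = (if t > 0 then exp (- t) else 1))"

lemma (in prob_space) standard_exponential_iff_distributed:
  "standard_exponential M X \<longleftrightarrow> distributed M lborel X (exponential_density 1)"
proof
  assume X: "distributed M lborel X (exponential_density 1)"
  have [measurable]: "X \<in> borel_measurable M"
    using distributed_measurable[OF X] by simp
  have gt: "prob {x \<in> space M. X x > a} = exp (- a)" if "a \<ge> 0" for a
    using exponential_distributedD_gt[OF X that] by simp
  have "prob {x \<in> space M. X x \<ge> t} = (if t > 0 then exp (- t) else 1)" for t
  proof -
    have eq: "prob {x \<in> space M. X x = t} = 0"
    proof -
      have "AE x in lborel. (x::real) \<noteq> t"
        by (rule AE_lborel_singleton)
      hence "AE x in density lborel (exponential_density 1). x \<noteq> t"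
        by (subst AE_density) auto
      hence "AE x in distr M lborel X. x \<noteq> t"
        unfolding distributed_distr_eq_density[OF X] .
      hence "AE x in M. X x \<noteq> t"
        by (subst (asm) AE_distr_iff) auto
      thus ?thesis by (subst prob_eq_0) auto
    qed
    show ?thesis
    proof (cases "t > 0")
      case True
      have "{x \<in> space M. X x \<ge> t} = {x \<in> space M. X x > t} \<union> {x \<in> space M. X x = t}"
        by auto
      also have "prob \<dots> = prob {x \<in> space M. X x > t} + prob {x \<in> space M. X x = t}"
        by (rule finite_measure_Union) auto
      finally show ?thesis using True gt eq by simp
    next
      case False
      have "1 = prob {x \<in> space M. X x > 0}" using gt[of 0] by simp
      also have "\<dots> \<le> prob {x \<in> space M. X x \<ge> t}"
        using False by (intro finite_measure_mono) auto
      finally show ?thesis using False by (simp add: antisym)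
    qed
  qed
  thus "standard_exponential M X" by (simp add: standard_exponential_def)
next
  assume X: "standard_exponential M X"
  have [measurable]: "X \<in> borel_measurable M" using X by (simp add: standard_exponential_def)
  have ge: "prob {x \<in> space M. X x \<ge> t} = exp (- t)" if "t \<ge> 0" for t
    using X that by (auto simp: standard_exponential_def)
  have "prob {x \<in> space M. X x \<le> a} = 1 - exp (- a)" if a: "a \<ge> 0" for a
  proof -
    let ?A = "\<lambda>k::nat. {x \<in> space M. X x \<ge> a + 1 / Suc k}"
    have "incseq ?A"
    proof (rule incseq_SucI, clarify)
      fix k x assume "a + 1 / real (Suc k) \<le> X x"
      moreover have "1 / real (Suc (Suc k)) \<le> 1 / real (Suc k)" by (simp add: frac_le)
      ultimately show "a + 1 / real (Suc (Suc k)) \<le> X x" by linarith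
    qed
    hence "(\<lambda>k. prob (?A k)) \<longlonglongrightarrow> prob (\<Union>k. ?A k)"
      by (intro finite_Lim_measure_incseq) auto
    also have "(\<Union>k. ?A k) = {x \<in> space M. X x > a}"
    proof (intro equalityI subsetI)
      fix x assume "x \<in> {x \<in> space M. X x > a}"
      moreover from this obtain k where "1 / real (Suc k) < X x - a"
        using nat_approx_posE[of "X x - a"] by auto
      ultimately have "x \<in> ?A k" by (auto simp: field_simps)
      thus "x \<in> (\<Union>k. ?A k)" by blast
    next
      fix x assume "x \<in> (\<Union>k. ?A k)"
      then obtain k where "x \<in> space M" "a + 1 / real (Suc k) \<le> X x" by blast
      moreover have "0 < 1 / real (Suc k)" by simp
      ultimately have "a < X x" by linarith
      with \<open>x \<in> space M\<close> show "x \<in> {x \<in> space M. X x > a}" by simp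
    qed
    also have "(\<lambda>k. prob (?A k)) = (\<lambda>k. exp (- (a + 1 / real (Suc k))))"
      using a by (intro ext ge) (simp del: of_nat_Suc)
    finally have L: "(\<lambda>k. exp (- (a + 1 / real (Suc k)))) \<longlonglongrightarrow> prob {x \<in> space M. X x > a}" .
    have "(\<lambda>k. exp (- (a + inverse (real (Suc k))))) \<longlonglongrightarrow> exp (- (a + 0))"
      by (intro tendsto_intros LIMSEQ_inverse_real_of_nat)
    hence "prob {x \<in> space M. X x > a} = exp (- a)"
      using LIMSEQ_unique[OF L] by (simp add: inverse_eq_divide)
    moreover have "prob {x \<in> space M. \<not> X x \<le> a} = 1 - prob {x \<in> space M. X x \<le> a}"
      by (rule prob_neg) auto
    ultimately show ?thesis by (simp add: not_le)
  qed
  thus "distributed M lborel X (exponential_density 1)"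
    by (subst exponential_distributed_iff) auto
qed

end

theory Submission
  imports Defs
begin

text \<open>
  A permutation \<open>\<pi>\<close> contributes \<open>\<Prod> (w i j * \<gamma> i j) ^ D i j\<close> to the permanent, where \<open>D i j\<close> counts the
  \<open>k \<in> R i\<close> with \<open>\<pi> k \<in> C j\<close>. The \<open>d\<close>-th moment of a standard exponential variable is \<open>d!\<close>, so by
  independence the expected contribution is \<open>\<Prod> w i j ^ D i j * (D i j)!\<close>, and exactly
  \<open>\<Prod> (r i)! * \<Prod> (c j)! / \<Prod> (D i j)!\<close> permutations have table \<open>D\<close>.
\<close>

section \<open>Counting permutations by fibres\<close>

lemma sum_card_fibres:
  assumes "finite X" "finite I" "f ` X \<subseteq> I"
  shows "(\<Sum>i\<in>I. card {x \<in> X. f x = i \<and> P x}) = card {x \<in> X. P x}"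
proof -
  have "(\<Sum>i\<in>I. \<Sum>x\<in>{x \<in> {x \<in> X. P x}. f x = i}. 1) = (\<Sum>x\<in>{x \<in> X. P x}. 1::nat)"
    by (rule sum.group) (use assms in auto)
  moreover have "{x \<in> {x \<in> X. P x}. f x = i} = {x \<in> X. f x = i \<and> P x}" for i
    by auto
  ultimately show ?thesis by simp
qed

lemma card_eq_card_mult_fibre:
  assumes "finite S" "finite H" "\<phi> ` S \<subseteq> H" "\<And>h. h \<in> H \<Longrightarrow> card {s \<in> S. \<phi> s = h} = k"
  shows "card S = card H * k"
  using sum_card_fibres[OF assms(1-3), of "\<lambda>_. True"] assms(4) by simp

text \<open>Such a \<sigma> is a free choice, for each \<open>i\<close>, of a bijection from the
  fibre of \<open>g\<close> over \<open>i\<close> onto the equally large fibre of \<open>f\<close>.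
  The induction removes one point \<open>a\<close> and writes \<sigma> as a transposition after a
  permutation of the rest; \<open>f\<close> has to vary because it absorbs the
  transposition.\<close>

lemma card_permutations_prescribed:
  fixes f g :: "'a \<Rightarrow> 'b"
  assumes "finite X" "finite I" "g ` X \<subseteq> I"
    and "\<And>i. card {x \<in> X. f x = i} = card {x \<in> X. g x = i}"
  shows "card {\<sigma>. \<sigma> permutes X \<and> (\<forall>x\<in>X. f (\<sigma> x) = g x)} = (\<Prod>i\<in>I. fact (card {x \<in> X. g x = i}))"
  using assms(1,3,4)
proof (induction X arbitrary: f rule: finite_induct)
  case empty
  then show ?case by simp
next
  case (insert a F)
  let ?\<tau> = "Transposition.transpose a"
  let ?fib = "\<lambda>X i. {x \<in> X. g x = i}"
  \<comment> \<open>Cardinalities become indicator sums to fit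
    \<open>sum_over_permutations_insert\<close>, which splits a sum over permutations.\<close>
  have conv: "card {\<sigma>. \<sigma> permutes X \<and> P \<sigma>} = (\<Sum>\<sigma> | \<sigma> permutes X. if P \<sigma> then 1 else 0)"
    if "finite X" for X :: "'a set" and P
    using finite_permutations[OF that] by (simp add: sum.If_cases Int_def)
  \<comment> \<open>Since \<open>q\<close> fixes \<open>a\<close>, the composite sends
    \<open>a\<close> to \<open>b\<close>. The condition at \<open>a\<close> is thus
    \<open>f b = g a\<close>, and the remaining ones form an instance of the induction
    hypothesis.\<close>
  have step: "card {q. q permutes F \<and> (\<forall>x\<in>insert a F. f ((?\<tau> b \<circ> q) x) = g x)} =
      (if f b = g a then \<Prod>i\<in>I. fact (card (?fib F i)) else 0)" if b: "b \<in> insert a F" for b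
  proof (cases "f b = g a")
    case True
    have eq: "{q. q permutes F \<and> (\<forall>x\<in>insert a F. f ((?\<tau> b \<circ> q) x) = g x)} =
        {q. q permutes F \<and> (\<forall>x\<in>F. (f \<circ> ?\<tau> b) (q x) = g x)}"
      using True insert.hyps(2) by (auto simp: permutes_not_in)
    \<comment> \<open>Dropping \<open>b\<close> from the fibres of \<open>f\<close> and
      \<open>a\<close> from those of \<open>g\<close> lowers the sizes over the same value, because
      \<open>f b = g a\<close>; so the sizes still agree.\<close>
    have card_eq: "card {x \<in> F. (f \<circ> ?\<tau> b) x = i} = card (?fib F i)" for i
    proof -
      have "bij_betw (?\<tau> b) {x \<in> F. (f \<circ> ?\<tau> b) x = i} ({x \<in> insert a F. f x = i} - {b})"
      proof (rule bij_betw_byWitness[where f' = "?\<tau> b"])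
        show "?\<tau> b ` {x \<in> F. (f \<circ> ?\<tau> b) x = i} \<subseteq> {x \<in> insert a F. f x = i} - {b}"
          using b insert.hyps(2) by (auto simp: Transposition.transpose_def)
        show "?\<tau> b ` ({x \<in> insert a F. f x = i} - {b}) \<subseteq> {x \<in> F. (f \<circ> ?\<tau> b) x = i}"
          using b insert.hyps(2) by (auto simp: Transposition.transpose_def)
      qed auto
      hence "card {x \<in> F. (f \<circ> ?\<tau> b) x = i} = card ({x \<in> insert a F. f x = i} - {b})"
        by (rule bij_betw_same_card)
      also have "\<dots> = card {x \<in> insert a F. f x = i} - (if f b = i then 1 else 0)"
        using b insert.hyps(1) by (auto simp: card_Diff_singleton_if)
      also have "\<dots> = card (?fib (insert a F) i) - (if g a = i then 1 else 0)"
        using insert.prems True by simp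
      also have "\<dots> = card (?fib (insert a F) i - {a})"
        using insert.hyps(1) by (auto simp: card_Diff_singleton_if)
      also have "?fib (insert a F) i - {a} = ?fib F i"
        using insert.hyps(2) by auto
      finally show ?thesis .
    qed
    show ?thesis
      unfolding eq using insert.IH[of "f \<circ> ?\<tau> b"] insert.prems True card_eq by simp
  next
    case False
    hence "{q. q permutes F \<and> (\<forall>x\<in>insert a F. f ((?\<tau> b \<circ> q) x) = g x)} = {}"
      using insert.hyps(2) by (auto simp: permutes_not_in)
    with False show ?thesis by (simp only: card.empty if_False)
  qed
  have split: "?fib (insert a F) i = (if i = g a then insert a (?fib F i) else ?fib F i)" for i
    by auto
  have "card {\<sigma>. \<sigma> permutes insert a F \<and> (\<forall>x\<in>insert a F. f (\<sigma> x) = g x)} =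
      (\<Sum>b\<in>insert a F. card {q. q permutes F \<and> (\<forall>x\<in>insert a F. f ((?\<tau> b \<circ> q) x) = g x)})"
    unfolding conv[OF finite.insertI[OF insert.hyps(1)]] conv[OF insert.hyps(1)]
    by (rule sum_over_permutations_insert[OF insert.hyps(1,2)])
  also have "\<dots> = (\<Sum>b\<in>insert a F. if f b = g a then \<Prod>i\<in>I. fact (card (?fib F i)) else 0)"
    by (rule sum.cong[OF refl step])
  also have "\<dots> = card {b \<in> insert a F. f b = g a} * (\<Prod>i\<in>I. fact (card (?fib F i)))"
    using insert.hyps(1) by (simp only: sum.inter_filter[symmetric] finite_insert sum_constant) simp
  \<comment> \<open>These are the admissible images of \<open>a\<close>: the fibre of
    \<open>f\<close> over \<open>g a\<close> is as large as that of \<open>g\<close>, which consists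
    of \<open>a\<close> and its part in \<open>F\<close>. The factor turns the factorial at
    \<open>g a\<close> into the next one.\<close>
  also have "card {b \<in> insert a F. f b = g a} = Suc (card (?fib F (g a)))"
    using insert.hyps insert.prems(2) split by simp
  also have "Suc (card (?fib F (g a))) * (\<Prod>i\<in>I. fact (card (?fib F i))) =
      (\<Prod>i\<in>I. if i = g a then Suc (card (?fib F i)) else 1) * (\<Prod>i\<in>I. fact (card (?fib F i)))"
    using insert.prems(1) assms(2) by simp
  also have "\<dots> = (\<Prod>i\<in>I. fact (card (?fib (insert a F) i)))"
    unfolding prod.distrib[symmetric] split using insert.hyps by (intro prod.cong refl) simp
  finally show ?case .
qed

text \<open>Each fibre of \<rho> can be cut into pieces of sizes \<open>D i j\<close>, since these
  add up to its size; a bijection to the disjoint union of the sets \<open>{..<D i j}\<close> labels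
  every point with its piece. This supplies the reference map \<open>h\<^sub>0\<close> of the count
  below.\<close>

lemma ex_second_coordinate:
  assumes "finite X" "finite J" "\<rho> ` X \<subseteq> I"
    and "\<And>i. i \<in> I \<Longrightarrow> (\<Sum>j\<in>J. D i j) = card {x \<in> X. \<rho> x = i}"
  shows "\<exists>h\<in>X \<rightarrow>\<^sub>E J. \<forall>i\<in>I. \<forall>j\<in>J. card {x \<in> X. \<rho> x = i \<and> h x = j} = D i j"
proof -
  have "\<exists>b. bij_betw b {x \<in> X. \<rho> x = i} (SIGMA j:J. {..<D i j})" if "i \<in> I" for i
    using assms that by (intro finite_same_card_bij) auto
  then obtain b where b: "\<And>i. i \<in> I \<Longrightarrow> bij_betw (b i) {x \<in> X. \<rho> x = i} (SIGMA j:J. {..<D i j})"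
    by metis
  define h where "h = restrict (\<lambda>x. fst (b (\<rho> x) x)) X"
  have "fst (b (\<rho> x) x) \<in> J" if "x \<in> X" for x
    using bij_betwE[OF b[of "\<rho> x"]] assms(3) that by force
  hence "h \<in> X \<rightarrow>\<^sub>E J"
    by (simp add: h_def)
  moreover have "card {x \<in> X. \<rho> x = i \<and> h x = j} = D i j" if ij: "i \<in> I" "j \<in> J" for i j
  proof -
    have inj: "inj_on (b i) {x \<in> X. \<rho> x = i}"
      and img: "b i ` {x \<in> X. \<rho> x = i} = (SIGMA j:J. {..<D i j})"
      using b[OF ij(1)] by (auto simp: bij_betw_def)
    have "b i ` {x \<in> X. \<rho> x = i \<and> h x = j} = {p \<in> b i ` {x \<in> X. \<rho> x = i}. fst p = j}"
      by (auto simp: h_def)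
    also have "\<dots> = {j} \<times> {..<D i j}"
      unfolding img using ij by auto
    finally have "card (b i ` {x \<in> X. \<rho> x = i \<and> h x = j}) = D i j"
      by (simp add: card_cartesian_product)
    moreover have "inj_on (b i) {x \<in> X. \<rho> x = i \<and> h x = j}"
      using inj by (rule inj_on_subset) auto
    ultimately show ?thesis by (simp add: card_image)
  qed
  ultimately show ?thesis by blast
qed

text \<open>
  Every \<open>h : X \<rightarrow> J\<close> such that \<open>(\<rho>, h)\<close> has table \<open>D\<close> equals \<open>\<kappa> \<circ> \<pi>\<close> for the same number of
  permutations \<open>\<pi>\<close>, and arises from a fixed such \<open>h\<^sub>0\<close> as \<open>h\<^sub>0 \<circ> \<sigma>\<close> for \<open>\<Prod> (D i j)!\<close> of the
  permutations \<open>\<sigma>\<close> that preserve \<open>\<rho>\<close>.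
\<close>

lemma card_permutations_table:
  assumes X: "finite X" and I: "finite I" and J: "finite J"
    and \<rho>: "\<rho> ` X \<subseteq> I" and \<kappa>: "\<kappa> ` X \<subseteq> J"
    and rows: "\<And>i. i \<in> I \<Longrightarrow> (\<Sum>j\<in>J. D i j) = card {x \<in> X. \<rho> x = i}"
    and cols: "\<And>j. j \<in> J \<Longrightarrow> (\<Sum>i\<in>I. D i j) = card {x \<in> X. \<kappa> x = j}"
  shows "card {\<pi>. \<pi> permutes X \<and> (\<forall>i\<in>I. \<forall>j\<in>J. card {x \<in> X. \<rho> x = i \<and> \<kappa> (\<pi> x) = j} = D i j)} *
      (\<Prod>i\<in>I. \<Prod>j\<in>J. fact (D i j)) =
    (\<Prod>i\<in>I. fact (card {x \<in> X. \<rho> x = i})) * (\<Prod>j\<in>J. fact (card {x \<in> X. \<kappa> x = j}))"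
proof -
  define S where "S = {\<pi>. \<pi> permutes X \<and> (\<forall>i\<in>I. \<forall>j\<in>J. card {x \<in> X. \<rho> x = i \<and> \<kappa> (\<pi> x) = j} = D i j)}"
  define H where "H = {h \<in> X \<rightarrow>\<^sub>E J. \<forall>i\<in>I. \<forall>j\<in>J. card {x \<in> X. \<rho> x = i \<and> h x = j} = D i j}"
  define G where "G = {\<sigma>. \<sigma> permutes X \<and> (\<forall>x\<in>X. \<rho> (\<sigma> x) = \<rho> x)}"
  have finS: "finite S" and finG: "finite G"
    using finite_permutations[OF X] by (auto simp: S_def G_def)
  have finH: "finite H"
    using finite_PiE[OF X, of "\<lambda>_. J"] J by (auto simp: H_def)
  obtain h\<^sub>0 where h\<^sub>0: "h\<^sub>0 \<in> H"
    using ex_second_coordinate[OF X J \<rho> rows] by (auto simp: H_def)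
  have H_J: "h x \<in> J" if "h \<in> H" "x \<in> X" for h x
    using that by (auto simp: H_def)
  \<comment> \<open>\<open>card_permutations_prescribed\<close> compares fibres over all values, so
    pairs outside \<open>I \<times> J\<close> are covered too; no point of \<open>X\<close> is sent
    there.\<close>
  have pair_fibre: "card {x \<in> X. (\<rho> x, h x) = p} = (if p \<in> I \<times> J then D (fst p) (snd p) else 0)"
    if "h \<in> H" for h p
  proof (cases "p \<in> I \<times> J")
    case True
    then show ?thesis using that by (auto simp: H_def)
  next
    case False
    hence "{x \<in> X. (\<rho> x, h x) = p} = {}"
      using \<rho> H_J[OF that] by auto
    with False show ?thesis by (simp only: card.empty if_False)
  qed
  have "card S = card H * (\<Prod>j\<in>J. fact (card {x \<in> X. \<kappa> x = j}))"
  proof (rule card_eq_card_mult_fibre[OF finS finH])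
    show "(\<lambda>\<pi>. restrict (\<kappa> \<circ> \<pi>) X) ` S \<subseteq> H"
      using \<kappa> by (auto simp: S_def H_def permutes_in_image cong: conj_cong)
    fix h assume h: "h \<in> H"
    \<comment> \<open>Summing the table of \<open>h\<close> over the rows gives the column sums of
      \<open>D\<close>, which are the fibre sizes of \<kappa>.\<close>
    have fibre: "card {x \<in> X. \<kappa> x = j} = card {x \<in> X. h x = j}" for j
    proof (cases "j \<in> J")
      case True
      have "card {x \<in> X. h x = j} = (\<Sum>i\<in>I. card {x \<in> X. \<rho> x = i \<and> h x = j})"
        by (rule sum_card_fibres[OF X I \<rho>, symmetric])
      also have "\<dots> = (\<Sum>i\<in>I. D i j)"
        using h True by (simp add: H_def)
      finally show ?thesis using cols[OF True] by simp
    next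
      case False
      hence "{x \<in> X. \<kappa> x = j} = {}" "{x \<in> X. h x = j} = {}"
        using \<kappa> H_J[OF h] by auto
      thus ?thesis by (simp only:)
    qed
    have "{\<pi> \<in> S. restrict (\<kappa> \<circ> \<pi>) X = h} = {\<pi>. \<pi> permutes X \<and> (\<forall>x\<in>X. \<kappa> (\<pi> x) = h x)}"
      using h by (auto simp: S_def H_def fun_eq_iff PiE_def extensional_def cong: conj_cong)
    also have "card \<dots> = (\<Prod>j\<in>J. fact (card {x \<in> X. h x = j}))"
      by (rule card_permutations_prescribed[OF X J _ fibre]) (use H_J[OF h] in auto)
    finally show "card {\<pi> \<in> S. restrict (\<kappa> \<circ> \<pi>) X = h} = (\<Prod>j\<in>J. fact (card {x \<in> X. \<kappa> x = j}))"
      by (simp add: fibre)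
  qed
  moreover have "card G = card H * (\<Prod>i\<in>I. \<Prod>j\<in>J. fact (D i j))"
  proof (rule card_eq_card_mult_fibre[OF finG finH])
    show "(\<lambda>\<sigma>. restrict (h\<^sub>0 \<circ> \<sigma>) X) ` G \<subseteq> H"
    proof clarify
      fix \<sigma> assume \<sigma>: "\<sigma> \<in> G"
      hence perm: "\<sigma> permutes X" and pres: "\<And>x. x \<in> X \<Longrightarrow> \<rho> (\<sigma> x) = \<rho> x"
        by (auto simp: G_def)
      have "card {x \<in> X. \<rho> x = i \<and> restrict (h\<^sub>0 \<circ> \<sigma>) X x = j} = card {x \<in> X. \<rho> x = i \<and> h\<^sub>0 x = j}" for i j
      proof -
        \<comment> \<open>As \<sigma> preserves \<rho>, it carries each cell of
          \<open>h\<^sub>0 \<circ> \<sigma>\<close> onto the same cell of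
          \<open>h\<^sub>0\<close>.\<close>
        have "card {x \<in> X. \<rho> x = i \<and> restrict (h\<^sub>0 \<circ> \<sigma>) X x = j} =
            card (\<sigma> ` {x \<in> X. \<rho> x = i \<and> restrict (h\<^sub>0 \<circ> \<sigma>) X x = j})"
          by (rule card_image[symmetric]) (rule inj_on_subset[OF permutes_inj[OF perm] subset_UNIV])
        also have "\<sigma> ` {x \<in> X. \<rho> x = i \<and> restrict (h\<^sub>0 \<circ> \<sigma>) X x = j} =
            {x \<in> \<sigma> ` X. \<rho> x = i \<and> h\<^sub>0 x = j}"
          using pres by (auto simp: image_iff)
        also have "\<sigma> ` X = X"
          by (rule permutes_image[OF perm])
        finally show ?thesis .
      qed
      moreover have "restrict (h\<^sub>0 \<circ> \<sigma>) X \<in> X \<rightarrow>\<^sub>E J"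
        using H_J[OF h\<^sub>0] perm by (auto simp: permutes_in_image)
      ultimately show "restrict (h\<^sub>0 \<circ> \<sigma>) X \<in> H"
        using h\<^sub>0 by (simp add: H_def)
    qed
    fix h assume h: "h \<in> H"
    \<comment> \<open>Preserving \<rho> and turning \<open>h\<^sub>0\<close> into \<open>h\<close>
      is a single condition on pairs, whose fibres are the cells of the table.\<close>
    have "{\<sigma> \<in> G. restrict (h\<^sub>0 \<circ> \<sigma>) X = h} =
        {\<sigma>. \<sigma> permutes X \<and> (\<forall>x\<in>X. (\<rho> (\<sigma> x), h\<^sub>0 (\<sigma> x)) = (\<rho> x, h x))}"
      using h by (auto simp: G_def H_def fun_eq_iff PiE_def extensional_def)
    also have "card \<dots> = (\<Prod>p\<in>I \<times> J. fact (card {x \<in> X. (\<rho> x, h x) = p}))"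
      by (rule card_permutations_prescribed[where f = "\<lambda>x. (\<rho> x, h\<^sub>0 x)", OF X])
        (use I J \<rho> H_J[OF h] pair_fibre[OF h] pair_fibre[OF h\<^sub>0] in auto)
    also have "\<dots> = (\<Prod>i\<in>I. \<Prod>j\<in>J. fact (D i j))"
      unfolding prod.cartesian_product by (intro prod.cong) (auto simp: pair_fibre[OF h, simplified])
    finally show "card {\<sigma> \<in> G. restrict (h\<^sub>0 \<circ> \<sigma>) X = h} = (\<Prod>i\<in>I. \<Prod>j\<in>J. fact (D i j))" .
  qed
  moreover have "card G = (\<Prod>i\<in>I. fact (card {x \<in> X. \<rho> x = i}))"
    unfolding G_def by (rule card_permutations_prescribed[OF X I \<rho> refl])
  \<comment> \<open>The two expressions for \<open>card G\<close> eliminate the unknown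
    \<open>card H\<close> from the formula for \<open>card S\<close>, without any division.\<close>
  ultimately show ?thesis
    unfolding S_def[symmetric] by (simp add: mult_ac)
qed

section \<open>Moments of independent exponential variables\<close>

lemma (in prob_space) has_bochner_integral_prod_power_exponential:
  fixes Y :: "'i \<Rightarrow> 'a \<Rightarrow> real"
  assumes I: "finite I" and indep: "indep_vars (\<lambda>_. borel) Y I"
    and expo: "\<And>i. i \<in> I \<Longrightarrow> standard_exponential M (Y i)"
  shows "has_bochner_integral M (\<lambda>\<omega>. \<Prod>i\<in>I. Y i \<omega> ^ d i) (\<Prod>i\<in>I. fact (d i))"
proof -
  have mom: "has_bochner_integral M (\<lambda>\<omega>. Y i \<omega> ^ d i) (fact (d i))" if "i \<in> I" for i
    \<comment> \<open>The exponential density is the Erlang density of shape 0; at rate 1 its moment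
      of order \<open>d i\<close> is \<open>fact (0 + d i) / (fact 0 * 1 ^ d i)\<close>.\<close>
    using has_bochner_integral_erlang_ith_moment[of 1 "Y i" 0 "d i"] expo[OF that]
    by (simp add: standard_exponential_iff_distributed)
  have ind: "indep_vars (\<lambda>_. borel) (\<lambda>i \<omega>. Y i \<omega> ^ d i) I"
    by (rule indep_vars_compose2[OF indep]) simp
  have int: "integrable M (\<lambda>\<omega>. Y i \<omega> ^ d i)" if "i \<in> I" for i
    using mom[OF that] by (simp add: has_bochner_integral_iff)
  show ?thesis
    using indep_vars_integrable[OF I ind int] indep_vars_lebesgue_integral[OF I ind int]
    by (simp add: has_bochner_integral_iff has_bochner_integral_integral_eq[OF mom])
qed

section \<open>The expected permanent as a sum over tables\<close>

text \<open>Recasts a block partition as an index map, the form in which the counting lemmas take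
  it. Disjointness leaves one possible index for each point, so the fibres of the chosen map are the
  blocks.\<close>

lemma disjoint_family_index:
  assumes "(\<Union>i\<in>I. R i) = X" "disjoint_family_on R I"
  obtains \<rho> where "\<rho> ` X \<subseteq> I" "\<And>i. i \<in> I \<Longrightarrow> {x \<in> X. \<rho> x = i} = R i"
proof -
  have "\<forall>x\<in>X. \<exists>i\<in>I. x \<in> R i"
    using assms(1) by blast
  then obtain \<rho> where \<rho>: "\<And>x. x \<in> X \<Longrightarrow> \<rho> x \<in> I \<and> x \<in> R (\<rho> x)"
    by metis
  have "{x \<in> X. \<rho> x = i} = R i" if "i \<in> I" for i
    using \<rho> that assms unfolding disjoint_family_on_def by blast
  with \<rho> show ?thesis by (intro that[of \<rho>]) auto
qed

theorem theorem1p2: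
  fixes m n N :: nat
    and r c :: "nat \<Rightarrow> nat"
    and w :: "nat \<Rightarrow> nat \<Rightarrow> real"
    and M :: "'a measure"
    and \<gamma> :: "nat \<Rightarrow> nat \<Rightarrow> 'a \<Rightarrow> real"
    and R C :: "nat \<Rightarrow> nat set"
    and A :: "'a \<Rightarrow> nat \<Rightarrow> nat \<Rightarrow> real"
  assumes r_pos: "\<And>i. i \<in> {1..m} \<Longrightarrow> 0 < r i"
    and c_pos: "\<And>j. j \<in> {1..n} \<Longrightarrow> 0 < c j"
    and r_sum: "(\<Sum>i=1..m. r i) = N"
    and c_sum: "(\<Sum>j=1..n. c j) = N"
    and M: "prob_space M"
    and \<gamma>_indep: "prob_space.indep_vars M (\<lambda>_. borel) (\<lambda>(i, j). \<gamma> i j) ({1..m} \<times> {1..n})"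
    and \<gamma>_exp: "\<And>i j. i \<in> {1..m} \<Longrightarrow> j \<in> {1..n} \<Longrightarrow> standard_exponential M (\<gamma> i j)"
    and R_Un: "(\<Union>i\<in>{1..m}. R i) = {1..N}"
    and R_disj: "disjoint_family_on R {1..m}"
    and R_card: "\<And>i. i \<in> {1..m} \<Longrightarrow> card (R i) = r i"
    and C_Un: "(\<Union>j\<in>{1..n}. C j) = {1..N}"
    and C_disj: "disjoint_family_on C {1..n}"
    and C_card: "\<And>j. j \<in> {1..n} \<Longrightarrow> card (C j) = c j"
    and A: "\<And>\<omega> i j p q. \<omega> \<in> space M \<Longrightarrow> i \<in> {1..m} \<Longrightarrow> j \<in> {1..n} \<Longrightarrow> p \<in> R i \<Longrightarrow> q \<in> C j
              \<Longrightarrow> A \<omega> p q = w i j * \<gamma> i j \<omega>"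
  shows "integrable M (\<lambda>\<omega>. permanent N (A \<omega>)) \<and>
         weighted_tables m n r c w =
           prob_space.expectation M (\<lambda>\<omega>. permanent N (A \<omega>)) /
             ((\<Prod>i=1..m. fact (r i)) * (\<Prod>j=1..n. fact (c j)))"
proof -
  interpret prob_space M by (rule M)
  obtain \<rho> where \<rho>: "\<rho> ` {1..N} \<subseteq> {1..m}" and R: "\<And>i. i \<in> {1..m} \<Longrightarrow> {k \<in> {1..N}. \<rho> k = i} = R i"
    using disjoint_family_index[OF R_Un R_disj] by metis
  obtain \<kappa> where \<kappa>: "\<kappa> ` {1..N} \<subseteq> {1..n}" and C: "\<And>j. j \<in> {1..n} \<Longrightarrow> {k \<in> {1..N}. \<kappa> k = j} = C j"
    using disjoint_family_index[OF C_Un C_disj] by metis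
  let ?P = "{\<pi>. \<pi> permutes {1..N}}" and ?I = "{1..m} \<times> {1..n}"
  define tab where "tab \<pi> i j = card {k \<in> {1..N}. \<rho> k = i \<and> \<kappa> (\<pi> k) = j}" for \<pi> i j
  \<comment> \<open>The factorials are the moments of the exponential variables, so this is the
    expected contribution of any permutation with table \<open>D\<close>.\<close>
  define weight where "weight D = (\<Prod>i=1..m. \<Prod>j=1..n. w i j ^ D i j * fact (D i j))" for D
  have \<kappa>\<pi>: "(\<lambda>k. \<kappa> (\<pi> k)) ` {1..N} \<subseteq> {1..n}" if "\<pi> \<in> ?P" for \<pi>
    using \<kappa> that by (auto simp: permutes_in_image simp del: atLeastAtMost_iff)
  have tab_in: "tab \<pi> \<in> contingency_tables m n r c" if \<pi>: "\<pi> \<in> ?P" for \<pi>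
  proof -
    have "tab \<pi> i j = 0" if "(i, j) \<notin> ?I" for i j
      using \<rho> \<kappa>\<pi>[OF \<pi>] that unfolding tab_def card_eq_0_iff by blast
    moreover have "(\<Sum>j=1..n. tab \<pi> i j) = r i" if "i \<in> {1..m}" for i
    proof -
      have "(\<Sum>j=1..n. tab \<pi> i j) = card {k \<in> {1..N}. \<rho> k = i}"
        unfolding tab_def using sum_card_fibres[OF _ _ \<kappa>\<pi>[OF \<pi>], of "\<lambda>k. \<rho> k = i"]
        by (simp add: conj_ac)
      thus ?thesis using R[OF that] R_card[OF that] by simp
    qed
    moreover have "(\<Sum>i=1..m. tab \<pi> i j) = c j" if "j \<in> {1..n}" for j
    proof -
      have perm: "\<pi> permutes {1..N}"
        using \<pi> by simp
      have "(\<Sum>i=1..m. tab \<pi> i j) = card {k \<in> {1..N}. \<kappa> (\<pi> k) = j}"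
        unfolding tab_def by (rule sum_card_fibres[OF _ _ \<rho>]) auto
      \<comment> \<open>Injectivity of \<pi> allows positions to be counted through their images,
        which fill the column block.\<close>
      also have "\<dots> = card (\<pi> ` {k \<in> {1..N}. \<kappa> (\<pi> k) = j})"
        using card_image[OF inj_on_subset[OF permutes_inj[OF perm] subset_UNIV]] by simp
      also have "\<pi> ` {k \<in> {1..N}. \<kappa> (\<pi> k) = j} = {k \<in> \<pi> ` {1..N}. \<kappa> k = j}"
        by auto
      also have "\<dots> = C j"
        using C[OF that] by (simp only: permutes_image[OF perm])
      finally show ?thesis using C_card[OF that] by simp
    qed
    ultimately show ?thesis unfolding contingency_tables_def by blast
  qed
  have A_eq: "A \<omega> k (\<pi> k) = w (\<rho> k) (\<kappa> (\<pi> k)) * \<gamma> (\<rho> k) (\<kappa> (\<pi> k)) \<omega>"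
    if "\<omega> \<in> space M" "\<pi> \<in> ?P" "k \<in> {1..N}" for \<omega> \<pi> k
  proof (rule A[OF that(1)])
    have \<pi>k: "\<pi> k \<in> {1..N}"
      using that permutes_in_image[of \<pi>] by blast
    show "\<rho> k \<in> {1..m}" "\<kappa> (\<pi> k) \<in> {1..n}"
      using \<rho> \<kappa> that(3) \<pi>k by blast+
    thus "k \<in> R (\<rho> k)" "\<pi> k \<in> C (\<kappa> (\<pi> k))"
      using R C that(3) \<pi>k by blast+
  qed
  \<comment> \<open>The factors are grouped by block, and block \<open>(i, j)\<close> is met
    \<open>tab \<pi> i j\<close> times. Splitting the powers separates the constants from the random
    variables; a block that is never met has exponent 0 and gives 1 even if \<open>w i j\<close> is
    0.\<close>
  have prod_A: "(\<Prod>k=1..N. A \<omega> k (\<pi> k)) =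
      (\<Prod>(i, j)\<in>?I. w i j ^ tab \<pi> i j) * (\<Prod>p\<in>?I. (case p of (i, j) \<Rightarrow> \<gamma> i j) \<omega> ^ case_prod (tab \<pi>) p)"
    if \<omega>: "\<omega> \<in> space M" and \<pi>: "\<pi> \<in> ?P" for \<omega> \<pi>
  proof -
    let ?h = "\<lambda>(i, j). w i j * \<gamma> i j \<omega>" and ?g = "\<lambda>k. (\<rho> k, \<kappa> (\<pi> k))"
    have "(\<Prod>k=1..N. A \<omega> k (\<pi> k)) = (\<Prod>k=1..N. ?h (?g k))"
      using A_eq[OF \<omega> \<pi>] by (intro prod.cong) auto
    also have "\<dots> = (\<Prod>p\<in>?I. \<Prod>k | k \<in> {1..N} \<and> ?g k = p. ?h (?g k))"
      by (rule prod.group[symmetric]) (use \<rho> \<kappa>\<pi>[OF \<pi>] in auto)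
    also have "\<dots> = (\<Prod>p\<in>?I. ?h p ^ case_prod (tab \<pi>) p)"
    proof (rule prod.cong[OF refl])
      fix p
      have "(\<Prod>k | k \<in> {1..N} \<and> ?g k = p. ?h (?g k)) = (\<Prod>k | k \<in> {1..N} \<and> ?g k = p. ?h p)"
        by (rule prod.cong) auto
      also have "\<dots> = ?h p ^ case_prod (tab \<pi>) p"
        by (cases p) (simp add: tab_def)
      finally show "(\<Prod>k | k \<in> {1..N} \<and> ?g k = p. ?h (?g k)) = ?h p ^ case_prod (tab \<pi>) p" .
    qed
    finally show ?thesis
      by (simp add: prod.distrib[symmetric] case_prod_beta power_mult_distrib)
  qed
  have "has_bochner_integral M (\<lambda>\<omega>. \<Prod>k=1..N. A \<omega> k (\<pi> k)) (weight (tab \<pi>))" if \<pi>: "\<pi> \<in> ?P" for \<pi>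
  proof -
    let ?W = "\<Prod>(i, j)\<in>?I. w i j ^ tab \<pi> i j"
    have "has_bochner_integral M (\<lambda>\<omega>. ?W * (\<Prod>p\<in>?I. (case p of (i, j) \<Rightarrow> \<gamma> i j) \<omega> ^ case_prod (tab \<pi>) p))
        (?W * (\<Prod>p\<in>?I. fact (case_prod (tab \<pi>) p)))"
      using \<gamma>_exp
      by (intro has_bochner_integral_mult_right has_bochner_integral_prod_power_exponential \<gamma>_indep) auto
    also have "?W * (\<Prod>p\<in>?I. fact (case_prod (tab \<pi>) p)) = weight (tab \<pi>)"
      by (simp add: weight_def prod.cartesian_product prod.distrib[symmetric] case_prod_beta)
    \<comment> \<open>The factorization \<open>prod_A\<close> is available only on
      \<open>space M\<close>, which suffices for the integral.\<close>
    finally show ?thesis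
      using prod_A[OF _ \<pi>] by (subst has_bochner_integral_cong[OF refl _ refl]) auto
  qed
  hence per: "has_bochner_integral M (\<lambda>\<omega>. permanent N (A \<omega>)) (\<Sum>\<pi>\<in>?P. weight (tab \<pi>))"
    unfolding permanent_def by (rule has_bochner_integral_sum)
  \<comment> \<open>The factorials inside \<open>weight D\<close> are exactly those that
    \<open>card_permutations_table\<close> multiplies the count by, so only the powers of
    \<open>w\<close> and the factorials of the margins remain.\<close>
  have count: "real (card {\<pi> \<in> ?P. tab \<pi> = D}) * weight D =
      (\<Prod>i=1..m. \<Prod>j=1..n. w i j ^ D i j) * ((\<Prod>i=1..m. fact (r i)) * (\<Prod>j=1..n. fact (c j)))"
    if D: "D \<in> contingency_tables m n r c" for D
  proof -
    have rows: "(\<Sum>j=1..n. D i j) = card {k \<in> {1..N}. \<rho> k = i}" if "i \<in> {1..m}" for i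
      using D R_card[OF that] R[OF that] that unfolding contingency_tables_def by simp
    have cols: "(\<Sum>i=1..m. D i j) = card {k \<in> {1..N}. \<kappa> k = j}" if "j \<in> {1..n}" for j
      using D C_card[OF that] C[OF that] that unfolding contingency_tables_def by simp
    \<comment> \<open>Both tables vanish outside the index range, so equality of functions reduces
      to the cells that \<open>card_permutations_table\<close> inspects.\<close>
    have "tab \<pi> = D \<longleftrightarrow> (\<forall>i\<in>{1..m}. \<forall>j\<in>{1..n}. tab \<pi> i j = D i j)" if "\<pi> \<in> ?P" for \<pi>
    proof
      assume eq: "\<forall>i\<in>{1..m}. \<forall>j\<in>{1..n}. tab \<pi> i j = D i j"
      have "tab \<pi> i j = D i j" for i j
      proof (cases "(i, j) \<in> ?I")
        case False
        thus ?thesis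
          using D tab_in[OF that] unfolding contingency_tables_def mem_Collect_eq by metis
      qed (use eq in auto)
      thus "tab \<pi> = D" by blast
    qed auto
    hence "{\<pi> \<in> ?P. tab \<pi> = D} = {\<pi>. \<pi> permutes {1..N} \<and> (\<forall>i\<in>{1..m}. \<forall>j\<in>{1..n}. tab \<pi> i j = D i j)}"
      by blast
    hence "card {\<pi> \<in> ?P. tab \<pi> = D} * (\<Prod>i=1..m. \<Prod>j=1..n. fact (D i j)) =
        (\<Prod>i=1..m. fact (card {k \<in> {1..N}. \<rho> k = i})) * (\<Prod>j=1..n. fact (card {k \<in> {1..N}. \<kappa> k = j}))"
      using card_permutations_table[OF _ _ _ \<rho> \<kappa> rows cols] by (simp add: tab_def)
    also have "\<dots> = (\<Prod>i=1..m. fact (r i)) * (\<Prod>j=1..n. fact (c j))"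
      by (intro arg_cong2[of _ _ _ _ "(*)"] prod.cong refl) (use R C R_card C_card in simp_all)
    finally have nat_eq: "card {\<pi> \<in> ?P. tab \<pi> = D} * (\<Prod>i=1..m. \<Prod>j=1..n. fact (D i j)) =
        (\<Prod>i=1..m. fact (r i)) * (\<Prod>j=1..n. fact (c j))" .
    have "real (card {\<pi> \<in> ?P. tab \<pi> = D}) * (\<Prod>i=1..m. \<Prod>j=1..n. fact (D i j)) =
        (\<Prod>i=1..m. fact (r i)) * (\<Prod>j=1..n. fact (c j))"
      using arg_cong[OF nat_eq, of real] by (simp only: of_nat_mult of_nat_prod of_nat_fact)
    thus ?thesis
      by (simp add: weight_def prod.distrib mult_ac)
  qed
  \<comment> \<open>Permutations are grouped by their tables, since the summand depends on \<pi>
    only through \<open>tab \<pi>\<close>.\<close>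
  have "(\<Sum>\<pi>\<in>?P. weight (tab \<pi>)) =
      (\<Sum>D\<in>contingency_tables m n r c. real (card {\<pi> \<in> ?P. tab \<pi> = D}) * weight D)"
    by (rule sum_fun_comp) (use tab_in finite_contingency_tables in \<open>auto intro: finite_permutations\<close>)
  also have "\<dots> = weighted_tables m n r c w * ((\<Prod>i=1..m. fact (r i)) * (\<Prod>j=1..n. fact (c j)))"
    unfolding weighted_tables_def sum_distrib_right by (rule sum.cong[OF refl count])
  finally show ?thesis
    using per by (simp add: has_bochner_integral_iff)
qed

end
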